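(* Let $T$ be an arbitrary (finite) graph and $n$ a positive integer. Then $$\widetilde\chi(\mathrm{Hom}(T,K_n))=\sum_{\emptyset\neq S\subseteq V(T)}(-1)^{n+|S|}\,\widetilde\chi(\mathrm{Ind}(T[S]))^n.$$
   Context: Graphs are finite, undirected, without multiple edges. $T[S]$ is the subgraph of $T$ induced by $S$. $K_n$ is the complete loopless graph on $n$ vertices. $\mathrm{Hom}(T,G)$ is the subcomplex of $\prod_{x\in V(T)}\Delta^{V(G)}$ consisting of all cells $\prod_{x\in V(T)}\sigma_x$, with each $\sigma_x$ a nonempty subset of $V(G)$, such that whenever $(x,y)\in E(T)$ one has $\sigma_x\times\sigma_y\subseteq E(G)$. The independence complex $\mathrm{Ind}(T)$ is the simplicial complex whose simplices are the independent sets of $T$, i.e. sets of vertices with no edge of $T$ joining two of them (in particular, if loops are present, a looped vertex lies in no independent set). $\widetilde\chi=\chi-1$ denotes the reduced Euler characteristic, so $\widetilde\chi(\emptyset)=-1$. *)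

theory Defs
  imports "Graph_Theory.Graph_Theory" "HOL-Library.FuncSet"
begin

text \<open>
  A finite complex of cells is given by its set of (nonempty) cells together with their
  dimensions; its Euler characteristic is the alternating sum of the numbers of cells of each
  dimension.
\<close>

definition euler_char :: "('c \<Rightarrow> nat) \<Rightarrow> 'c set \<Rightarrow> int" where
  "euler_char dm C = (\<Sum>d\<in>dm ` C. (-1) ^ d * int (card {c \<in> C. dm c = d}))"

definition reduced_euler_char :: "('c \<Rightarrow> nat) \<Rightarrow> 'c set \<Rightarrow> int" where
  "reduced_euler_char dm C = euler_char dm C - 1"

text \<open>A simplex is identified with its nonempty finite vertex set.\<close>

definition simplex_dim :: "'v set \<Rightarrow> nat" where
  "simplex_dim \<sigma> = card \<sigma> - 1"

definition full_simplex :: "'v set \<Rightarrow> 'v set set" where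
  "full_simplex V = Pow V - {{}}"

text \<open>
  The product cell with factors \<open>\<sigma> x\<close>, for \<open>x\<close> in the index set \<open>I\<close>, is encoded as the function
  \<open>\<sigma>\<close>, extensional on \<open>I\<close>, so that distinct functions are distinct cells.
\<close>

definition prod_of_simplices :: "'i set \<Rightarrow> ('i \<Rightarrow> 'v set) \<Rightarrow> ('i \<Rightarrow> 'v set) set" where
  "prod_of_simplices I V = (\<Pi>\<^sub>E x\<in>I. full_simplex (V x))"

definition prod_cell_dim :: "'i set \<Rightarrow> ('i \<Rightarrow> 'v set) \<Rightarrow> nat" where
  "prod_cell_dim I \<sigma> = (\<Sum>x\<in>I. simplex_dim (\<sigma> x))"

definition Hom_complex ::
  "('a, 'b) pre_digraph \<Rightarrow> ('c, 'd) pre_digraph \<Rightarrow> ('a \<Rightarrow> 'c set) set" where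
  "Hom_complex T G =
     {\<sigma> \<in> prod_of_simplices (verts T) (\<lambda>_. verts G).
        \<forall>(x, y) \<in> arcs_ends T. \<sigma> x \<times> \<sigma> y \<subseteq> arcs_ends G}"

text \<open>In the next definition \<open>x = y\<close> is allowed: a looped vertex lies in no independent set.\<close>

definition independent_set :: "('a, 'b) pre_digraph \<Rightarrow> 'a set \<Rightarrow> bool" where
  "independent_set T A \<longleftrightarrow> A \<subseteq> verts T \<and> (\<forall>x\<in>A. \<forall>y\<in>A. (x, y) \<notin> arcs_ends T)"

text \<open>The empty independent set is not a cell.\<close>

definition Ind_complex :: "('a, 'b) pre_digraph \<Rightarrow> 'a set set" where
  "Ind_complex T = {A. A \<noteq> {} \<and> independent_set T A}"

definition reduced_euler_char_Hom ::
  "('a, 'b) pre_digraph \<Rightarrow> ('c, 'd) pre_digraph \<Rightarrow> int" where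
  "reduced_euler_char_Hom T G =
     reduced_euler_char (prod_cell_dim (verts T)) (Hom_complex T G)"

definition reduced_euler_char_Ind :: "('a, 'b) pre_digraph \<Rightarrow> int" where
  "reduced_euler_char_Ind T = reduced_euler_char simplex_dim (Ind_complex T)"

end

theory Submission
  imports Defs
begin

text \<open>
  Transposing a cell \<open>\<sigma>\<close> of \<open>Hom(T, K\<^sub>n)\<close> gives the colour classes \<open>A v = {x. v \<in> \<sigma> x}\<close>. The
  condition on edges says that each \<open>A v\<close> is a possibly empty independent set, and nonemptiness of
  every \<open>\<sigma> x\<close> says that the classes cover \<open>V(T)\<close>. The cell has dimension
  \<open>(\<Sum>v. |A v|) - |V(T)|\<close>. Inclusion-exclusion over the sets \<open>S\<close> that contain all the
  classes removes the covering condition, after which the sum over tuples factors into \<open>n\<close> equal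
  sums over independent sets of \<open>T[S]\<close>, each of value \<open>-\<chi>(Ind(T[S]))\<close> with \<open>\<chi>\<close> reduced.
  The term \<open>S = {}\<close> contributes the \<open>1\<close> that is subtracted in the reduced Euler characteristic.
\<close>

section \<open>Euler characteristics as signed sums over cells\<close>

lemma euler_char_eq_sum:
  assumes "finite C"
  shows "euler_char dm C = (\<Sum>c\<in>C. (-1) ^ dm c)"
proof -
  have "(\<Sum>c\<in>C. (-1) ^ dm c) = (\<Sum>d\<in>dm ` C. \<Sum>c\<in>{c \<in> C. dm c = d}. (-1) ^ dm c :: int)"
    by (rule sum.image_gen[OF assms])
  also have "\<dots> = (\<Sum>d\<in>dm ` C. (-1) ^ d * int (card {c \<in> C. dm c = d}))"
    by (intro sum.cong) auto
  finally show ?thesis by (simp add: euler_char_def)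
qed

text \<open>The dimension \<open>card A - 1\<close> flips the sign of every simplex, and the
  subtracted 1 becomes the summand of the empty independent set, which is not a cell.\<close>

lemma reduced_euler_char_Ind_eq_sum:
  assumes "finite (verts T)"
  shows "reduced_euler_char_Ind T = - (\<Sum>A | independent_set T A. (-1) ^ card A)"
proof -
  have fin: "finite {A. independent_set T A}"
    by (rule finite_subset[of _ "Pow (verts T)"]) (auto simp: independent_set_def assms)
  have all: "{A. independent_set T A} = insert {} (Ind_complex T)"
    by (auto simp: Ind_complex_def independent_set_def)
  have finI: "finite (Ind_complex T)" and nI: "{} \<notin> Ind_complex T"
    using fin by (auto simp: Ind_complex_def)
  have "(-1) ^ simplex_dim A = - ((-1) ^ card A :: int)" if "A \<in> Ind_complex T" for A
  proof -
    have "card A > 0"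
      using that assms finite_subset
      by (fastforce simp: Ind_complex_def independent_set_def card_gt_0_iff)
    then show ?thesis by (cases "card A") (auto simp: simplex_dim_def)
  qed
  then have "euler_char simplex_dim (Ind_complex T) = (\<Sum>A\<in>Ind_complex T. - ((-1) ^ card A))"
    by (simp add: euler_char_eq_sum[OF finI])
  then show ?thesis
    unfolding reduced_euler_char_Ind_def reduced_euler_char_def all
    using finI nI by (simp add: sum_negf)
qed

lemma independent_set_induce_subgraph:
  assumes "S \<subseteq> verts T"
  shows "independent_set (T \<restriction> S) A \<longleftrightarrow> A \<subseteq> S \<and> independent_set T A"
proof -
  have ends: "(x, y) \<in> arcs_ends (T \<restriction> S) \<longleftrightarrow> x \<in> S \<and> y \<in> S \<and> (x, y) \<in> arcs_ends T" for x y
    by (auto simp: arcs_ends_conv)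
  show ?thesis
    unfolding independent_set_def induce_subgraph_verts ends using assms by blast
qed

section \<open>Inclusion-exclusion for covering families\<close>

text \<open>Expand a product over \<open>V\<close> with factor \<open>1 + 0\<close> at points of
  \<open>U\<close> and \<open>1 + (-1)\<close> elsewhere: choosing the first summand at
  \<open>x\<close> means \<open>x \<in> S\<close>. One point outside \<open>U\<close> already makes
  the product vanish.\<close>

lemma sum_supersets_alternating:
  assumes "finite V" "U \<subseteq> V"
  shows "(\<Sum>S\<in>Pow V. if U \<subseteq> S then (-1) ^ card (V - S) else 0) =
    (if U = V then 1 else 0 :: 'a :: comm_ring_1)"
proof -
  have "(\<Sum>S\<in>Pow V. if U \<subseteq> S then (-1) ^ card (V - S) else 0) =
      (\<Sum>S\<in>Pow V. (\<Prod>x\<in>S. 1) * (\<Prod>x\<in>V - S. if x \<in> U then 0 else - 1 :: 'a))"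
  proof (intro sum.cong refl)
    fix S assume S: "S \<in> Pow V"
    have "(\<Prod>x\<in>V - S. if x \<in> U then 0 else - 1 :: 'a) = 0" if "\<not> U \<subseteq> S"
      using that assms by (intro prod_zero) auto
    moreover have "(\<Prod>x\<in>V - S. if x \<in> U then 0 else - 1 :: 'a) = (\<Prod>x\<in>V - S. - 1)" if "U \<subseteq> S"
      using that by (intro prod.cong) auto
    ultimately show "(if U \<subseteq> S then (-1) ^ card (V - S) else 0) =
        (\<Prod>x\<in>S. 1) * (\<Prod>x\<in>V - S. if x \<in> U then 0 else - 1 :: 'a)"
      by simp
  qed
  also have "\<dots> = (\<Prod>x\<in>V. 1 + (if x \<in> U then 0 else - 1))"
    by (rule prod_add[OF assms(1), symmetric])
  also have "\<dots> = (if U = V then 1 else 0)"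
    using assms by (auto intro!: prod_zero)
  finally show ?thesis .
qed

lemma sum_covering_families:
  fixes f :: "'x set \<Rightarrow> 'a :: comm_ring_1"
  assumes "finite V" "finite W" "F \<subseteq> Pow V"
  shows "(\<Sum>A | A \<in> W \<rightarrow>\<^sub>E F \<and> \<Union> (A ` W) = V. \<Prod>v\<in>W. f (A v)) =
    (\<Sum>S\<in>Pow V. (-1) ^ card (V - S) * (\<Sum>X | X \<in> F \<and> X \<subseteq> S. f X) ^ card W)"
proof -
  have finF: "finite F" using assms finite_subset by blast
  have finP: "finite (W \<rightarrow>\<^sub>E F)" using assms finF by (intro finite_PiE) auto
  have "(\<Sum>A | A \<in> W \<rightarrow>\<^sub>E F \<and> \<Union> (A ` W) = V. \<Prod>v\<in>W. f (A v)) =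
      (\<Sum>A\<in>W \<rightarrow>\<^sub>E F. if \<Union> (A ` W) = V then \<Prod>v\<in>W. f (A v) else 0)"
    using sum.inter_filter[OF finP, of "\<lambda>A. \<Prod>v\<in>W. f (A v)" "\<lambda>A. \<Union> (A ` W) = V"] by simp
  also have "\<dots> = (\<Sum>A\<in>W \<rightarrow>\<^sub>E F. \<Sum>S\<in>Pow V.
      if \<Union> (A ` W) \<subseteq> S then (-1) ^ card (V - S) * (\<Prod>v\<in>W. f (A v)) else 0)"
  proof (intro sum.cong refl)
    \<comment> \<open>The indicator of covering becomes a signed sum over the sets \<open>S\<close>
      that contain the union.\<close>
    fix A assume "A \<in> W \<rightarrow>\<^sub>E F"
    then have "\<Union> (A ` W) \<subseteq> V" using assms(3) by (auto simp: PiE_iff)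
    then have "(if \<Union> (A ` W) = V then \<Prod>v\<in>W. f (A v) else 0) = (\<Sum>S\<in>Pow V.
      if \<Union> (A ` W) \<subseteq> S then (-1) ^ card (V - S) else 0) * (\<Prod>v\<in>W. f (A v))"
      by (subst sum_supersets_alternating[OF assms(1)]) auto
    also have "\<dots> = (\<Sum>S\<in>Pow V.
      if \<Union> (A ` W) \<subseteq> S then (-1) ^ card (V - S) * (\<Prod>v\<in>W. f (A v)) else 0)"
      unfolding sum_distrib_right by (intro sum.cong) auto
    finally show "(if \<Union> (A ` W) = V then \<Prod>v\<in>W. f (A v) else 0) = (\<Sum>S\<in>Pow V.
      if \<Union> (A ` W) \<subseteq> S then (-1) ^ card (V - S) * (\<Prod>v\<in>W. f (A v)) else 0)" .
  qed
  also have "\<dots> = (\<Sum>S\<in>Pow V. \<Sum>A\<in>W \<rightarrow>\<^sub>E F.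
      if \<Union> (A ` W) \<subseteq> S then (-1) ^ card (V - S) * (\<Prod>v\<in>W. f (A v)) else 0)"
    by (rule sum.swap)
  also have "\<dots> = (\<Sum>S\<in>Pow V. (-1) ^ card (V - S) * (\<Sum>X | X \<in> F \<and> X \<subseteq> S. f X) ^ card W)"
  proof (intro sum.cong refl)
    fix S
    \<comment> \<open>Unlike covering, containment of the union in \<open>S\<close> restricts each
      \<open>A v\<close> separately. What remains is a full function space, over which the sum of
      products factors.\<close>
    have PiE_eq: "{A \<in> W \<rightarrow>\<^sub>E F. \<Union> (A ` W) \<subseteq> S} = W \<rightarrow>\<^sub>E {X. X \<in> F \<and> X \<subseteq> S}"
      by (rule set_eqI) (simp add: PiE_iff UN_subset_iff ball_conj_distrib conj_ac)
    have "(\<Sum>A\<in>W \<rightarrow>\<^sub>E F.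
        if \<Union> (A ` W) \<subseteq> S then (-1) ^ card (V - S) * (\<Prod>v\<in>W. f (A v)) else 0) =
      (\<Sum>A\<in>W \<rightarrow>\<^sub>E {X. X \<in> F \<and> X \<subseteq> S}. (-1) ^ card (V - S) * (\<Prod>v\<in>W. f (A v)))"
      unfolding PiE_eq[symmetric] by (rule sum.inter_filter[OF finP, symmetric])
    also have "\<dots> = (-1) ^ card (V - S) * (\<Prod>v\<in>W. \<Sum>X | X \<in> F \<and> X \<subseteq> S. f X)"
      using finF assms(2) by (subst prod_sum_PiE) (auto simp: sum_distrib_left)
    finally show "(\<Sum>A\<in>W \<rightarrow>\<^sub>E F.
        if \<Union> (A ` W) \<subseteq> S then (-1) ^ card (V - S) * (\<Prod>v\<in>W. f (A v)) else 0) =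
      (-1) ^ card (V - S) * (\<Sum>X | X \<in> F \<and> X \<subseteq> S. f X) ^ card W" by simp
  qed
  finally show ?thesis .
qed

section \<open>Cells of \<open>Hom_complex T K\<close> as families of colour classes\<close>

text \<open>Arcs of \<open>K\<close> join exactly the distinct vertices, so an arc from
  \<open>x\<close> to \<open>y\<close> in \<open>T\<close> demands that \<open>\<sigma> x\<close>
  and \<open>\<sigma> y\<close> be disjoint. A loop at \<open>x\<close> would force
  \<open>\<sigma> x\<close> to be empty, in accordance with \<open>x\<close> lying in no independent
  set.\<close>

lemma Hom_complex_complete_iff:
  assumes "wf_digraph T" "complete_digraph n K"
  shows "\<sigma> \<in> Hom_complex T K \<longleftrightarrow>
    \<sigma> \<in> verts T \<rightarrow>\<^sub>E full_simplex (verts K) \<and>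
    (\<forall>v\<in>verts K. independent_set T {x \<in> verts T. v \<in> \<sigma> x})"
proof -
  have ends: "arcs_ends K = {(u, v). u \<in> verts K \<and> v \<in> verts K \<and> u \<noteq> v}"
    using assms(2) by (auto simp: complete_digraph_def)
  have wf: "x \<in> verts T" "y \<in> verts T" if "(x, y) \<in> arcs_ends T" for x y
    using that assms(1) by (auto simp: arcs_ends_conv wf_digraph_def)
  have "(\<forall>(x, y)\<in>arcs_ends T. \<sigma> x \<times> \<sigma> y \<subseteq> arcs_ends K) \<longleftrightarrow>
    (\<forall>v\<in>verts K. independent_set T {x \<in> verts T. v \<in> \<sigma> x})"
    if "\<sigma> \<in> verts T \<rightarrow>\<^sub>E full_simplex (verts K)"
  proof -
    have sub: "\<sigma> x \<subseteq> verts K" if "x \<in> verts T" for x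
      using that \<open>\<sigma> \<in> _\<close> by (auto simp: PiE_iff full_simplex_def)
    have "\<sigma> x \<times> \<sigma> y \<subseteq> arcs_ends K \<longleftrightarrow> (\<forall>v\<in>verts K. \<not> (v \<in> \<sigma> x \<and> v \<in> \<sigma> y))"
      if "(x, y) \<in> arcs_ends T" for x y
      using sub[OF wf(1)[OF that]] sub[OF wf(2)[OF that]] unfolding ends by blast
    then show ?thesis
      using wf unfolding independent_set_def by blast
  qed
  then show ?thesis
    unfolding Hom_complex_def prod_of_simplices_def mem_Collect_eq
    by (rule conj_cong[OF refl])
qed

lemma sign_prod_cell_dim:
  assumes "finite V" "finite W" "\<sigma> \<in> V \<rightarrow>\<^sub>E full_simplex W"
  shows "(-1) ^ prod_cell_dim V \<sigma> =
    (-1) ^ card V * (\<Prod>v\<in>W. (-1) ^ card {x \<in> V. v \<in> \<sigma> x} :: int)"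
proof -
  have sub: "\<sigma> x \<subseteq> W" "\<sigma> x \<noteq> {}" if "x \<in> V" for x
    using that assms(3) by (auto simp: PiE_iff full_simplex_def)
  have "(-1) ^ simplex_dim (\<sigma> x) = - 1 * (-1 :: int) ^ card (\<sigma> x)" if "x \<in> V" for x
  \<comment> \<open>Nonemptiness matters: at the empty set the truncated \<open>card - 1\<close> is
    0 and the sign would be wrong.\<close>
  proof -
    have "card (\<sigma> x) > 0"
      using sub[OF that] assms(2) finite_subset by (auto simp: card_gt_0_iff)
    then show ?thesis by (cases "card (\<sigma> x)") (auto simp: simplex_dim_def)
  qed
  then have "(-1) ^ prod_cell_dim V \<sigma> = (\<Prod>x\<in>V. - 1 * (-1) ^ card (\<sigma> x) :: int)"
    unfolding prod_cell_dim_def power_sum by (intro prod.cong) auto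
  also have "\<dots> = (-1) ^ card V * (-1) ^ (\<Sum>x\<in>V. card (\<sigma> x))"
    unfolding prod.distrib power_sum by simp
  also have "(\<Sum>x\<in>V. card (\<sigma> x)) = (\<Sum>x\<in>V. card {v \<in> W. v \<in> \<sigma> x})"
    using sub by (intro sum.cong arg_cong[of _ _ card]) auto
  \<comment> \<open>Double counting of the pairs \<open>(x, v)\<close> with
    \<open>v \<in> \<sigma> x\<close>.\<close>
  also have "\<dots> = (\<Sum>v\<in>W. card {x \<in> V. v \<in> \<sigma> x})"
    using assms(1,2) by (intro sum_multicount_gen) auto
  finally show ?thesis unfolding power_sum .
qed

lemma euler_char_Hom_complete:
  assumes "fin_digraph T" "complete_digraph n K"
  shows "euler_char (prod_cell_dim (verts T)) (Hom_complex T K) =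
    (-1) ^ card (verts T) *
    (\<Sum>A | A \<in> verts K \<rightarrow>\<^sub>E {X. independent_set T X} \<and> \<Union> (A ` verts K) = verts T.
      \<Prod>v\<in>verts K. (-1) ^ card (A v))"
proof -
  interpret fin_digraph T by fact
  have finK: "finite (verts K)"
    using assms(2) unfolding complete_digraph_def
    by (meson fin_digraph.finite_verts graph_def pseudo_graph_def)
  note iff = Hom_complex_complete_iff[OF wf_digraph assms(2)]
  have "finite (Hom_complex T K)"
  proof (rule finite_subset)
    show "Hom_complex T K \<subseteq> verts T \<rightarrow>\<^sub>E full_simplex (verts K)"
      unfolding subset_iff iff by blast
    show "finite (verts T \<rightarrow>\<^sub>E full_simplex (verts K))"
      using finK by (intro finite_PiE) (auto simp: full_simplex_def)
  qed
  then have "euler_char (prod_cell_dim (verts T)) (Hom_complex T K) =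
      (\<Sum>\<sigma>\<in>Hom_complex T K. (-1) ^ prod_cell_dim (verts T) \<sigma>)"
    by (rule euler_char_eq_sum)
  also have "\<dots> =
    (\<Sum>A | A \<in> verts K \<rightarrow>\<^sub>E {X. independent_set T X} \<and> \<Union> (A ` verts K) = verts T.
      (-1) ^ card (verts T) * (\<Prod>v\<in>verts K. (-1) ^ card (A v)))"
  \<comment> \<open>Both witnesses transpose the incidence relation
    \<open>v \<in> \<sigma> x\<close>. They are restricted to their index sets because cells and
    families are extensional.\<close>
  proof (rule sum.reindex_bij_witness[where
        i = "\<lambda>A. \<lambda>x\<in>verts T. {v \<in> verts K. x \<in> A v}" and
        j = "\<lambda>\<sigma>. \<lambda>v\<in>verts K. {x \<in> verts T. v \<in> \<sigma> x}"])
    fix \<sigma> assume \<sigma>: "\<sigma> \<in> Hom_complex T K"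
    then have cell: "\<sigma> \<in> verts T \<rightarrow>\<^sub>E full_simplex (verts K)"
      and sub: "\<And>x. x \<in> verts T \<Longrightarrow> \<sigma> x \<subseteq> verts K \<and> \<sigma> x \<noteq> {}"
      by (auto simp: iff PiE_iff full_simplex_def)
    show "(\<lambda>x\<in>verts T. {v \<in> verts K. x \<in> (\<lambda>v\<in>verts K. {x \<in> verts T. v \<in> \<sigma> x}) v}) = \<sigma>"
    proof
      fix x
      show "(\<lambda>x\<in>verts T. {v \<in> verts K. x \<in> (\<lambda>v\<in>verts K. {x \<in> verts T. v \<in> \<sigma> x}) v}) x = \<sigma> x"
        using sub PiE_arb[OF cell] by (cases "x \<in> verts T") auto
    qed
    show "(\<lambda>v\<in>verts K. {x \<in> verts T. v \<in> \<sigma> x}) \<in>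
      {A. A \<in> verts K \<rightarrow>\<^sub>E {X. independent_set T X} \<and> \<Union> (A ` verts K) = verts T}"
      using \<sigma> sub by (fastforce simp: iff)
    show "(-1) ^ card (verts T) *
        (\<Prod>v\<in>verts K. (-1) ^ card ((\<lambda>v\<in>verts K. {x \<in> verts T. v \<in> \<sigma> x}) v)) =
      ((-1) ^ prod_cell_dim (verts T) \<sigma> :: int)"
      by (simp add: sign_prod_cell_dim[OF finite_verts finK cell])
  next
    fix A assume "A \<in> {A. A \<in> verts K \<rightarrow>\<^sub>E {X. independent_set T X} \<and>
      \<Union> (A ` verts K) = verts T}"
    then have A: "A \<in> verts K \<rightarrow>\<^sub>E {X. independent_set T X}"
      and cover: "\<Union> (A ` verts K) = verts T"
      by auto
    \<comment> \<open>Intersecting with \<open>verts T\<close> loses nothing, since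
      \<open>cover\<close> puts each class inside it.\<close>
    have classes: "{x \<in> verts T. v \<in> (\<lambda>x\<in>verts T. {v \<in> verts K. x \<in> A v}) x} = A v"
      if "v \<in> verts K" for v
      using that cover by auto
    show "(\<lambda>v\<in>verts K. {x \<in> verts T. v \<in> (\<lambda>x\<in>verts T. {v \<in> verts K. x \<in> A v}) x}) = A"
    proof
      fix v
      show "(\<lambda>v\<in>verts K. {x \<in> verts T. v \<in> (\<lambda>x\<in>verts T. {v \<in> verts K. x \<in> A v}) x}) v = A v"
        using classes PiE_arb[OF A] by (cases "v \<in> verts K") auto
    qed
    show "(\<lambda>x\<in>verts T. {v \<in> verts K. x \<in> A v}) \<in> Hom_complex T K"
      unfolding iff
    proof (intro conjI ballI)
      \<comment> \<open>Covering gives every vertex at least one colour, hence a nonempty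
        simplex.\<close>
      show "(\<lambda>x\<in>verts T. {v \<in> verts K. x \<in> A v}) \<in> verts T \<rightarrow>\<^sub>E full_simplex (verts K)"
        using cover by (fastforce simp: full_simplex_def)
      fix v assume "v \<in> verts K"
      then show "independent_set T
          {x \<in> verts T. v \<in> (\<lambda>x\<in>verts T. {v \<in> verts K. x \<in> A v}) x}"
        using A by (subst classes) auto
    qed
  qed
  finally show ?thesis by (simp add: sum_distrib_left)
qed

theorem theorem6p2:
  fixes T :: "('a, 'b) pre_digraph"
    and K :: "('c, 'd) pre_digraph"
    and n :: nat
  assumes "pseudo_graph T" and "nomulti_digraph T"
    and "complete_digraph n K"
    and "n > 0"
  shows "reduced_euler_char_Hom T K =
    (\<Sum>S | S \<noteq> {} \<and> S \<subseteq> verts T.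
       (-1) ^ (n + card S) * reduced_euler_char_Ind (T \<restriction> S) ^ n)"
proof -
  interpret pseudo_graph T by fact
  let ?V = "verts T"
  let ?term = "\<lambda>S. (-1) ^ (n + card S) * reduced_euler_char_Ind (T \<restriction> S) ^ n"
  have card_K: "card (verts K) = n"
    using assms(3) by (simp add: complete_digraph_def)
  \<comment> \<open>An infinite set has \<open>card\<close> 0, so positivity of \<open>n\<close>
    gives finiteness.\<close>
  then have finK: "finite (verts K)"
    using assms(4) card_gt_0_iff by blast
  have term_eq: "(-1) ^ card ?V * ((-1) ^ card (?V - S) *
      (\<Sum>X | X \<in> {X. independent_set T X} \<and> X \<subseteq> S. (-1) ^ card X) ^ n) = ?term S"
    if "S \<in> Pow ?V" for S
  proof -
    have "S \<subseteq> ?V" "finite S" using that by (auto intro: finite_subset[OF _ finite_verts])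
    then have "{X. X \<in> {X. independent_set T X} \<and> X \<subseteq> S} = {X. independent_set (T \<restriction> S) X}"
      by (auto simp: independent_set_induce_subgraph)
    then have sum_eq: "(\<Sum>X | X \<in> {X. independent_set T X} \<and> X \<subseteq> S. (-1) ^ card X) =
        - 1 * reduced_euler_char_Ind (T \<restriction> S)"
      using \<open>finite S\<close> by (simp add: reduced_euler_char_Ind_eq_sum)
    have "card ?V = card S + card (?V - S)"
      using \<open>S \<subseteq> ?V\<close> \<open>finite S\<close> by (simp add: card_Diff_subset card_mono)
    \<comment> \<open>The exponents add up to \<open>card S\<close> plus twice
      \<open>card (?V - S)\<close>. The remaining factor \<open>(-1) ^ n\<close> of the summand
      comes from the minus sign in \<open>sum_eq\<close>.\<close>
    then have sign: "(-1) ^ card ?V * (-1) ^ card (?V - S) = ((-1) ^ card S :: int)"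
      by (simp add: power_add mult.assoc flip: power_mult_distrib)
    show ?thesis
      unfolding sum_eq power_mult_distrib mult.assoc[symmetric] sign
      by (simp add: power_add mult_ac)
  qed
  \<comment> \<open>The empty graph has reduced Euler characteristic -1, so its summand is
    \<open>(-1) ^ n * (-1) ^ n = 1\<close> and cancels the 1 subtracted on the left.\<close>
  have "{A. independent_set (T \<restriction> {}) A} = {{}}"
    by (auto simp: independent_set_def)
  then have "?term {} = 1"
    by (simp add: reduced_euler_char_Ind_eq_sum flip: power_mult_distrib)
  moreover have "euler_char (prod_cell_dim ?V) (Hom_complex T K) = (\<Sum>S\<in>Pow ?V. ?term S)"
  proof -
    have "{X. independent_set T X} \<subseteq> Pow ?V" by (auto simp: independent_set_def)
    then show ?thesis
      unfolding euler_char_Hom_complete[OF fin_digraph_axioms assms(3)]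
      by (subst sum_covering_families[OF finite_verts finK])
        (auto simp only: card_K sum_distrib_left intro!: sum.cong term_eq)
  qed
  moreover have "Pow ?V = insert {} {S. S \<noteq> {} \<and> S \<subseteq> ?V}" by auto
  ultimately show ?thesis
    unfolding reduced_euler_char_Hom_def reduced_euler_char_def by simp
qed

end
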